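(* Let $0<q<1$ and $n\ge n_0+1$. Let $\widetilde p(z)\ne p(z)$ be a complex polynomial of degree $\nu$ such that $$\|p-\widetilde p\,\|\le\min\left\{q\,m_1,\ \frac{q(1-q)m_1^2}{(2n+1)\delta_0\|p\|}\right\},$$ and let $\widetilde p(z)=\widetilde p_1(z)\widetilde p_2(z)$ be its factorization in which $\widetilde p_1$ is monic of degree $\varkappa$ with all zeros inside the unit circle and $\widetilde p_2$ has all zeros outside the unit circle. Then $$\|p_1-\widetilde p_1\|<\frac{(2n+1)\delta_0\|p\|}{(1-q)^2m_1^2}\left[\frac{\delta_0\|p\|}{m_K}\,\frac{1+\rho}{1-\rho}+1\right]\|p-\widetilde p\,\|$$ and $$\|p_2-\widetilde p_2\|<\frac{(2n+1)\delta_0^2\|p\|^2}{(1-q)^2m_1^2}\,\|p-\widetilde p\,\|.$$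
   Context: Let $p(z)$ be a monic complex polynomial of degree $\nu>1$ with $p(0)\ne0$ and with no zeros on the closed annulus $K=\{z\in\mathbb C: r\le|z|\le R\}$, where $0<r<1<R<\infty$. Let $\varkappa$ be the number of zeros of $p$ (with multiplicity) inside the unit circle; assume $0<\varkappa<\nu$, and put $n_0=\max\{\varkappa,\nu-\varkappa\}$. Write $p=p_1p_2$ where $p_1,p_2$ are monic, $\deg p_1=\varkappa$, $\deg p_2=\nu-\varkappa$, all zeros of $p_1$ lie in $\{|z|<r\}$ and all zeros of $p_2$ lie in $\{|z|>R\}$. Put $m_1=\min_{|z|=1}|p(z)|$, $m_K=\min_{z\in K}|p(z)|$, $\rho=\max\{r,1/R\}$. The norm $\|\cdot\|$ of a polynomial is the sum of the absolute values of its coefficients. $\delta_0$ denotes any real number such that $\|p_1\|\,\|p_2\|\le\delta_0\|p\|$ and $1\le\delta_0\le\delta^{\nu}\sqrt{(\varkappa+1)(\nu-\varkappa+1)}$, where $\delta=e^{2G/\pi}$ and $G$ is Catalan's constant. Since $\|p-\widetilde p\,\|<m_1$, the polynomial $\widetilde p$ has no zeros on the unit circle and has exactly $\varkappa$ zeros inside it, so the stated factorization of $\widetilde p$ exists. *)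

theory Defs
  imports "HOL-Analysis.Analysis" "HOL-Computational_Algebra.Polynomial"
begin

definition coeff_norm :: "complex poly \<Rightarrow> real" where
  "coeff_norm p = (\<Sum>i\<le>degree p. norm (coeff p i))"

definition closed_annulus :: "real \<Rightarrow> real \<Rightarrow> complex set" where
  "closed_annulus r R = {z. r \<le> norm z \<and> norm z \<le> R}"

(* The infimum is attained, hence is the minimum, when S is compact and nonempty. *)
definition min_modulus :: "complex set \<Rightarrow> complex poly \<Rightarrow> real" where
  "min_modulus S p = (INF z\<in>S. norm (poly p z))"

(* Zeros are counted with multiplicity; meaningful for p \<noteq> 0, whose zero set is finite. *)
definition zeros_in_unit_disc :: "complex poly \<Rightarrow> nat" where
  "zeros_in_unit_disc p = (\<Sum>z\<in>{z. poly p z = 0 \<and> norm z < 1}. order z p)"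

definition catalan_const :: real where
  "catalan_const = (\<Sum>k. (-1) ^ k / (2 * real k + 1) ^ 2)"

end

theory Submission
  imports Defs "HOL-Complex_Analysis.Complex_Analysis"
begin

text \<open>
  With \<open>u = p1 - pt1\<close> and \<open>v = p2 - pt2\<close> one has the exact identities
  \<open>p - pt = u * p2 + pt1 * v = u * pt2 + p1 * v\<close>. Dividing by \<open>pt1 * p2\<close>, respectively by \<open>p1 * pt2\<close>,
  exhibits a rational function with a known bound on the unit circle as the sum of a part that is
  analytic outside the circle and vanishes at infinity, and a part that is analytic inside; so the
  coefficients of \<open>v\<close> and \<open>u\<close> can be read off as means over the circle. The bound involves
  \<open>pt2\<close> (or \<open>pt1\<close>) only linearly, so the triangle inequality closes the estimate, and no control of
  \<open>coeff_norm pt1 * coeff_norm pt2\<close> is needed.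
\<close>

section \<open>Circle means and reversed polynomials\<close>

lemma has_integral_circle_eq_0:
  assumes "continuous_on (cball 0 1) g" "g holomorphic_on ball 0 1"
  shows "((\<lambda>t. cis t * g (cis t)) has_integral 0) {-pi..pi}"
proof -
  \<comment> \<open>The range \<open>{-pi..pi}\<close> is symmetric under
    \<open>t \<mapsto> -t\<close>, so that functions of \<open>1 / z\<close> can later be handled by
    reflecting the integral.\<close>
  have "(g has_contour_integral 0) (part_circlepath 0 1 (-pi) pi)"
  proof (rule Cauchy_theorem_convex[where K = "{}" and S = "cball 0 1"])
    show "g field_differentiable at x" if "x \<in> interior (cball 0 1) - {}" for x
      using that assms(2) by (auto simp: holomorphic_on_open field_differentiable_def)
    show "pathfinish (part_circlepath 0 1 (-pi) pi) = pathstart (part_circlepath 0 1 (-pi) pi)"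
      by (simp add: exp_minus)
    show "path_image (part_circlepath 0 1 (-pi) pi) \<subseteq> cball 0 1"
      using path_image_part_circlepath_subset[of "-pi" pi 1 0] by auto
  qed (use assms in auto)
  hence "((\<lambda>t. g (cis t) * \<i> * cis t) has_integral 0) {-pi..pi}"
    by (subst (asm) has_contour_integral_part_circlepath_iff) auto
  from has_integral_mult_right[OF this, of "-\<i>"] show ?thesis
    by (simp add: mult_ac)
qed

text \<open>Reversal with respect to a formal degree \<open>m\<close>. \<open>reflect_poly\<close>
  follows the actual degree, while for the numerators and truncations below only upper bounds on the
  degree are known.\<close>

definition reverse_to :: "nat \<Rightarrow> 'a::field poly \<Rightarrow> 'a poly" where
  "reverse_to m f = monom 1 (m - degree f) * reflect_poly f"

lemma poly_reverse_to:
  assumes "degree f \<le> m" "z \<noteq> 0"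
  shows "poly (reverse_to m f) (inverse z) = inverse z ^ m * poly f z"
  using assms by (simp add: reverse_to_def poly_monom poly_reflect_poly_nz flip: power_add)

lemma coeff_reverse_to:
  assumes "degree f \<le> m" "k \<le> m"
  shows "coeff (reverse_to m f) k = coeff f (m - k)"
  using assms by (auto simp: reverse_to_def coeff_monom_mult coeff_reflect_poly coeff_eq_0)

lemma degree_reverse_to:
  assumes "degree f \<le> m"
  shows "degree (reverse_to m f) \<le> m"
  unfolding reverse_to_def
  by (rule order.trans[OF degree_mult_le], use assms degree_reflect_poly_le[of f] degree_monom_le[of "1::'a" "m - degree f"] in linarith)

lemma poly_cutoff_add_shift: "p = poly_cutoff m p + monom 1 m * poly_shift m (p :: 'a::comm_semiring_1 poly)"
  by (rule poly_eqI) (auto simp: coeff_poly_cutoff coeff_poly_shift coeff_monom_mult)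

lemma degree_poly_cutoff: "degree (poly_cutoff (Suc m) p) \<le> m"
  by (rule degree_le) (auto simp: coeff_poly_cutoff)

lemma norm_poly_cutoff_le:
  fixes p :: "complex poly"
  assumes "norm z = 1"
  shows "norm (poly (poly_cutoff (Suc m) p) z) \<le> (\<Sum>i\<le>m. norm (coeff p i))"
proof -
  have "poly (poly_cutoff (Suc m) p) z = (\<Sum>i\<le>m. coeff (poly_cutoff (Suc m) p) i * z ^ i)"
    unfolding poly_altdef using degree_poly_cutoff[of m p]
    by (intro sum.mono_neutral_left) (auto simp: coeff_eq_0)
  also have "norm \<dots> \<le> (\<Sum>i\<le>m. norm (coeff (poly_cutoff (Suc m) p) i * z ^ i))"
    by (rule norm_sum)
  also have "\<dots> = (\<Sum>i\<le>m. norm (coeff p i))"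
    by (intro sum.cong) (auto simp: coeff_poly_cutoff norm_mult norm_power assms)
  finally show ?thesis .
qed

text \<open>Away from 0 the zeros of the reversal are reciprocals of zeros of \<open>a\<close>; at 0
  its value is the leading coefficient, nonzero because \<open>a\<close> is not the zero
  polynomial.\<close>

lemma reflect_poly_nonzero_on_disc:
  assumes "\<And>z. 1 \<le> norm z \<Longrightarrow> poly a z \<noteq> 0" "norm z \<le> (1::real)"
  shows "poly (reflect_poly a) (z::complex) \<noteq> 0"
proof (cases "z = 0")
  case True
  thus ?thesis using assms(1)[of 1] by auto
next
  case False
  thus ?thesis using assms(1)[of "inverse z"] assms(2)
    by (simp add: poly_reflect_poly_nz norm_inverse one_le_inverse)
qed

text \<open>
  The coefficient of \<open>z ^ k\<close> in \<open>v\<close> is the mean over the circle of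
  \<open>z powi (-k) * bk z * (u z / a z + v z / b z)\<close>, where \<open>bk\<close> is \<open>b\<close> truncated after degree \<open>k\<close>:
  the first summand is analytic in \<open>1 / z\<close> and vanishes at infinity, and replacing \<open>bk\<close> by \<open>b\<close>
  in the second one changes it by an analytic function that vanishes at 0.
\<close>
lemma norm_coeff_outer_le:
  fixes a b u v :: "complex poly"
  assumes a: "\<And>z. 1 \<le> norm z \<Longrightarrow> poly a z \<noteq> 0"
    and b: "\<And>z. norm z \<le> 1 \<Longrightarrow> poly b z \<noteq> 0"
    and deg: "degree u < degree a"
    and S: "\<And>z. norm z = 1 \<Longrightarrow> norm (poly u z / poly a z + poly v z / poly b z) \<le> S"
  shows "norm (coeff v k) \<le> (\<Sum>i\<le>k. norm (coeff b i)) * S"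
proof -
  define bk where "bk = poly_cutoff (Suc k) b"
  define A where "A = reflect_poly a"
  define U where "U = reverse_to (degree a - 1) u"
  define B where "B = reverse_to k bk"
  \<comment> \<open>\<open>V\<close> carries the part of \<open>v\<close> below degree
    \<open>k\<close>, with one factor \<open>1 / z\<close> taken out. That part is zero for
    \<open>k = 0\<close>, where \<open>k - 1\<close> would be the wrong formal degree.\<close>
  define V where "V = (if k = 0 then 0 else reverse_to (k - 1) (poly_cutoff k v))"
  define g where "g = (\<lambda>w. poly B w * (poly U w / poly A w) + poly V w)"
  define h where "h = (\<lambda>z. poly (poly_shift (Suc k) v) z
                        - poly (poly_shift (Suc k) b) z * poly v z / poly b z)"
  define F where "F = (\<lambda>z. inverse z ^ k * poly bk z * (poly u z / poly a z + poly v z / poly b z))"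
  have A: "poly A w \<noteq> 0" if "norm w \<le> 1" for w
    unfolding A_def using reflect_poly_nonzero_on_disc a that by blast
  have g: "((\<lambda>t. cis t * g (cis t)) has_integral 0) {-pi..pi}"
    unfolding g_def using A
    by (intro has_integral_circle_eq_0 holomorphic_intros continuous_intros) auto
  have h: "((\<lambda>t. cis t * h (cis t)) has_integral 0) {-pi..pi}"
    unfolding h_def using b
    by (intro has_integral_circle_eq_0 holomorphic_intros continuous_intros) auto
  have F: "F z = coeff v k + inverse z * g (inverse z) + z * h z" if z: "norm z = 1" for z
  proof -
    have z0: "z \<noteq> 0" using z by auto
    have nz: "poly a z \<noteq> 0" "poly b z \<noteq> 0" using a b z by auto
    have Az: "poly A (inverse z) = inverse z ^ degree a * poly a z"
      using poly_reverse_to[of a "degree a" z] z0 by (simp add: A_def reverse_to_def)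
    have Uz: "poly U (inverse z) = inverse z ^ (degree a - 1) * poly u z"
      unfolding U_def using deg z0 by (intro poly_reverse_to) auto
    \<comment> \<open>The strict degree inequality leaves the spare factor \<open>1 / z\<close>:
      this is the vanishing at infinity.\<close>
    have 1: "inverse z * (poly U (inverse z) / poly A (inverse z)) = poly u z / poly a z"
      unfolding Az Uz using z0 nz deg by (cases "degree a") (auto simp: field_simps)
    have 2: "poly B (inverse z) = inverse z ^ k * poly bk z"
      unfolding B_def bk_def using z0 by (intro poly_reverse_to degree_poly_cutoff)
    have 3: "inverse z * poly V (inverse z) = inverse z ^ k * poly (poly_cutoff k v) z"
    proof (cases k)
      case 0
      thus ?thesis by (simp add: V_def poly_eq_iff coeff_poly_cutoff poly_altdef)
    next
      case (Suc j)
      thus ?thesis using poly_reverse_to[OF degree_poly_cutoff[of j v] z0] by (simp add: V_def)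
    qed
    have "poly (poly_cutoff (Suc k) v) z = poly (poly_cutoff k v) z + coeff v k * z ^ k"
    proof -
      have "poly_cutoff (Suc k) v = poly_cutoff k v + monom (coeff v k) k"
        by (rule poly_eqI) (auto simp: coeff_poly_cutoff)
      thus ?thesis by (simp add: poly_monom)
    qed
    hence v: "poly v z = poly (poly_cutoff k v) z + coeff v k * z ^ k
                 + z ^ Suc k * poly (poly_shift (Suc k) v) z"
      using arg_cong[OF poly_cutoff_add_shift[of v "Suc k"], of "\<lambda>p. poly p z"]
      by (simp add: poly_monom)
    have b': "poly bk z = poly b z - z ^ Suc k * poly (poly_shift (Suc k) b) z"
      using arg_cong[OF poly_cutoff_add_shift[of b "Suc k"], of "\<lambda>p. poly p z"]
      by (simp add: poly_monom bk_def)
    \<comment> \<open>Writing \<open>bk\<close> as \<open>b\<close> minus its high part cancels the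
      denominator in \<open>v / b\<close>; the high part has a factor \<open>z ^ Suc k\<close>, of
      which \<open>z\<close> survives the division by \<open>z ^ k\<close>.\<close>
    have "F z = inverse z ^ k * poly bk z * (poly u z / poly a z) + inverse z ^ k * poly v z
               - z * (poly (poly_shift (Suc k) b) z * poly v z / poly b z)"
      using nz z0 by (simp add: F_def b' field_simps)
    also have "inverse z ^ k * poly v z = inverse z * poly V (inverse z) + coeff v k
                 + z * poly (poly_shift (Suc k) v) z"
      unfolding 3 using z0 by (subst v) (simp add: field_simps)
    also have "inverse z ^ k * poly bk z * (poly u z / poly a z)
                 = inverse z * (poly B (inverse z) * (poly U (inverse z) / poly A (inverse z)))"
      unfolding 1[symmetric] 2 by (simp add: mult_ac)
    finally show ?thesis by (simp add: g_def h_def algebra_simps)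
  qed
  have g': "((\<lambda>t. inverse (cis t) * g (inverse (cis t))) has_integral 0) {-pi..pi}"
    using has_integral_reflect_lemma_real[OF g] by (simp add: cis_inverse)
  have c: "((\<lambda>t. coeff v k) has_integral (2 * pi) *\<^sub>R coeff v k) {-pi..pi}"
    using has_integral_const_real[of "coeff v k" "-pi" pi] by simp
  have "((\<lambda>t. F (cis t)) has_integral (2 * pi) *\<^sub>R coeff v k + 0 + 0) {-pi..pi}"
    using has_integral_add[OF has_integral_add[OF c g'] h] by (simp add: F)
  moreover have "norm (F z) \<le> (\<Sum>i\<le>k. norm (coeff b i)) * S" if "norm z = 1" for z
    unfolding F_def bk_def norm_mult norm_power norm_inverse that
    by (simp, intro mult_mono norm_poly_cutoff_le S that sum_nonneg) auto
  moreover have "0 \<le> (\<Sum>i\<le>k. norm (coeff b i)) * S"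
    by (intro mult_nonneg_nonneg sum_nonneg order.trans[OF norm_ge_zero S[of 1]]) auto
  ultimately have "norm ((2 * pi) *\<^sub>R coeff v k)
      \<le> (\<Sum>i\<le>k. norm (coeff b i)) * S * measure lborel (cbox (-pi) pi)"
    by (intro has_integral_bound[of _ "\<lambda>t. F (cis t)"]) auto
  thus ?thesis by (simp add: mult_ac)
qed

section \<open>Estimates in the coefficient norm\<close>

lemma sum_norm_coeff_le: "(\<Sum>i\<le>k. norm (coeff p i)) \<le> coeff_norm p"
proof -
  have "(\<Sum>i\<le>k. norm (coeff p i)) = (\<Sum>i\<in>{..k} \<inter> {..degree p}. norm (coeff p i))"
    by (rule sum.mono_neutral_right) (auto intro: le_degree)
  also have "\<dots> \<le> (\<Sum>i\<le>degree p. norm (coeff p i))"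
    by (rule sum_mono2) auto
  finally show ?thesis by (simp add: coeff_norm_def)
qed

lemma coeff_norm_eq_sum:
  assumes "degree p \<le> m"
  shows "coeff_norm p = (\<Sum>i\<le>m. norm (coeff p i))"
  unfolding coeff_norm_def using assms
  by (intro sum.mono_neutral_left) (auto simp: coeff_eq_0)

lemma coeff_norm_le:
  assumes "degree p \<le> m" "\<And>k. k \<le> m \<Longrightarrow> norm (coeff p k) \<le> C"
  shows "coeff_norm p \<le> (real m + 1) * C"
  unfolding coeff_norm_eq_sum[OF assms(1)]
  using sum_bounded_above[of "{..m}" "\<lambda>i. norm (coeff p i)" C] assms(2) by (simp add: algebra_simps)

lemma coeff_norm_triangle: "coeff_norm p \<le> coeff_norm q + coeff_norm (q - p)"
proof -
  \<comment> \<open>\<open>coeff_norm\<close> sums up to the actual degree, so the three norms are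
    first brought to one index range.\<close>
  define m where "m = max (degree p) (max (degree q) (degree (q - p)))"
  have "(\<Sum>i\<le>m. norm (coeff p i)) \<le> (\<Sum>i\<le>m. norm (coeff q i) + norm (coeff (q - p) i))"
  proof (rule sum_mono)
    fix i
    show "norm (coeff p i) \<le> norm (coeff q i) + norm (coeff (q - p) i)"
      using norm_triangle_ineq4[of "coeff q i" "coeff (q - p) i"] by simp
  qed
  thus ?thesis
    by (simp add: coeff_norm_eq_sum[of _ m] m_def sum.distrib)
qed

lemma norm_poly_le_coeff_norm:
  assumes "norm z = 1"
  shows "norm (poly p z) \<le> coeff_norm p"
  unfolding coeff_norm_def poly_altdef using assms
  by (intro order.trans[OF norm_sum]) (simp add: norm_mult norm_power)

text \<open>Each truncated norm of \<open>b\<close> is at most the full norm, so the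
  \<open>m + 1\<close> coefficients of \<open>v\<close> share one bound.\<close>

lemma coeff_norm_outer_le:
  fixes a b u v :: "complex poly"
  assumes a: "\<And>z. 1 \<le> norm z \<Longrightarrow> poly a z \<noteq> 0"
    and b: "\<And>z. norm z \<le> 1 \<Longrightarrow> poly b z \<noteq> 0"
    and deg: "degree u < degree a" "degree v \<le> m"
    and S: "\<And>z. norm z = 1 \<Longrightarrow> norm (poly u z / poly a z + poly v z / poly b z) \<le> S"
  shows "coeff_norm v \<le> (real m + 1) * (coeff_norm b * S)"
proof (rule coeff_norm_le[OF deg(2)])
  fix k
  have "0 \<le> S" using order.trans[OF norm_ge_zero S[of 1]] by simp
  hence "(\<Sum>i\<le>k. norm (coeff b i)) * S \<le> coeff_norm b * S"
    by (intro mult_right_mono sum_norm_coeff_le)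
  moreover have "norm (coeff v k) \<le> (\<Sum>i\<le>k. norm (coeff b i)) * S"
    using a b deg(1) S by (rule norm_coeff_outer_le)
  ultimately show "norm (coeff v k) \<le> coeff_norm b * S" by linarith
qed

lemma coeff_norm_reverse_to:
  assumes "degree p \<le> m"
  shows "coeff_norm (reverse_to m p) = coeff_norm p"
proof -
  have "coeff_norm (reverse_to m p) = (\<Sum>i\<le>m. norm (coeff p (m - i)))"
    unfolding coeff_norm_eq_sum[OF degree_reverse_to[OF assms]]
    by (intro sum.cong) (simp_all add: coeff_reverse_to assms)
  also have "\<dots> = (\<Sum>i\<le>m. norm (coeff p i))"
    by (rule sum.reindex_bij_witness[of _ "\<lambda>i. m - i" "\<lambda>i. m - i"]) auto
  finally show ?thesis by (simp add: coeff_norm_eq_sum[OF assms])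
qed

lemma coeff_norm_inner_le:
  fixes a b u v :: "complex poly"
  assumes a: "\<And>z. 1 \<le> norm z \<Longrightarrow> poly a z \<noteq> 0"
    and b: "\<And>z. norm z \<le> 1 \<Longrightarrow> poly b z \<noteq> 0"
    and deg: "degree u < degree a" "degree v \<le> degree b"
    and S: "\<And>z. norm z = 1 \<Longrightarrow> norm (poly u z / poly a z + poly v z / poly b z) \<le> S"
  shows "coeff_norm u \<le> real (degree a) * (coeff_norm a * S)"
proof -
  \<comment> \<open>The substitution \<open>z \<mapsto> 1 / z\<close> exchanges the two summands; the extra factor \<open>z\<close> in \<open>B\<close> makes the
    one with \<open>v\<close> vanish at infinity even when \<open>degree v = degree b\<close>.\<close>
  define A where "A = reflect_poly a"
  define B where "B = pCons 0 (reflect_poly b)"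
  define U where "U = reverse_to (degree a - 1) u"
  define V where "V = reverse_to (degree b) v"
  have b0: "coeff b 0 \<noteq> 0" using b[of 0] by (simp add: poly_0_coeff_0)
  have degB: "degree B = Suc (degree b)"
    using b0 by (auto simp: B_def)
  have "coeff_norm U \<le> (real (degree a - 1) + 1) * (coeff_norm A * S)"
  proof (rule coeff_norm_outer_le[of B A V])
    fix z :: complex
    show "poly A z \<noteq> 0" if "norm z \<le> 1"
      unfolding A_def using reflect_poly_nonzero_on_disc a that by blast
    show "poly B z \<noteq> 0" if "1 \<le> norm z"
    proof -
      have "z \<noteq> 0" using that by auto
      thus ?thesis using b[of "inverse z"] that
        by (simp add: B_def poly_reflect_poly_nz norm_inverse inverse_le_1_iff)
    qed
    assume z: "norm z = 1"
    define w where "w = inverse z"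
    have w: "norm w = 1" "w \<noteq> 0" "z = inverse w" using z by (auto simp: w_def norm_inverse)
    have nz: "poly a w \<noteq> 0" "poly b w \<noteq> 0" using a b w by auto
    have Az: "poly A z = inverse w ^ degree a * poly a w"
      using poly_reverse_to[of a "degree a" w] w by (simp add: A_def reverse_to_def)
    have Bz: "poly B z = inverse w * (inverse w ^ degree b * poly b w)"
      using poly_reverse_to[of b "degree b" w] w by (simp add: B_def reverse_to_def)
    have Uz: "poly U z = inverse w ^ (degree a - 1) * poly u w"
      unfolding U_def w(3) using deg w by (intro poly_reverse_to) auto
    have Vz: "poly V z = inverse w ^ (degree b) * poly v w"
      unfolding V_def w(3) using deg w by (intro poly_reverse_to) auto
    \<comment> \<open>Both quotients pick up the same factor \<open>w\<close>, which has modulus 1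
      on the circle.\<close>
    have "poly V z / poly B z + poly U z / poly A z
            = w * (poly u w / poly a w + poly v w / poly b w)"
      unfolding Az Bz Uz Vz using nz w(2) deg(1)
      by (cases "degree a") (auto simp: field_simps)
    thus "norm (poly V z / poly B z + poly U z / poly A z) \<le> S"
      using S[OF w(1)] w(1) by (simp add: norm_mult)
  next
    show "degree V < degree B"
      using degree_reverse_to[OF deg(2)] by (simp add: degB V_def)
    show "degree U \<le> degree a - 1"
      unfolding U_def using deg by (intro degree_reverse_to) auto
  qed
  moreover have "coeff_norm U = coeff_norm u"
    unfolding U_def using deg by (intro coeff_norm_reverse_to) auto
  moreover have "coeff_norm A = coeff_norm a"
    using coeff_norm_reverse_to[of a "degree a"] by (simp add: A_def reverse_to_def)
  \<comment> \<open>Here \<open>degree a > 0\<close>, so \<open>degree a - 1 + 1\<close> is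
    \<open>degree a\<close>: one term fewer than for a general numerator.\<close>
  ultimately show ?thesis using deg(1) by simp
qed

text \<open>A minimum modulus principle: the reversal of \<open>a\<close> has value 1 at 0 and no
  zeros in the closed disc, so its modulus cannot exceed 1 on the whole circle. The coefficient
  estimate with \<open>u = 0\<close>, \<open>v = 1\<close>, \<open>k = 0\<close> yields
  this.\<close>

lemma monic_exists_norm_le_1:
  fixes a :: "complex poly"
  assumes a: "\<And>z. 1 \<le> norm z \<Longrightarrow> poly a z \<noteq> 0" and lead: "lead_coeff a = 1"
  shows "\<exists>z. norm z = 1 \<and> norm (poly a z) \<le> 1"
proof -
  have "\<exists>z\<in>sphere 0 1. \<forall>w\<in>sphere 0 1. norm (poly a z) \<le> norm (poly a w)"
    by (intro continuous_attains_inf continuous_intros) auto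
  then obtain z where z: "norm z = 1" "\<And>w. norm w = 1 \<Longrightarrow> norm (poly a z) \<le> norm (poly a w)"
    by auto
  have pos: "norm (poly a z) > 0" using a z(1) by simp
  have "norm (coeff (1 :: complex poly) 0) \<le> (\<Sum>i\<le>0. norm (coeff (reflect_poly a) i)) * inverse (norm (poly a z))"
  proof (rule norm_coeff_outer_le[of "[:0, 1:]" _ 0])
    fix w :: complex
    show "poly (reflect_poly a) w \<noteq> 0" if "norm w \<le> 1"
      using reflect_poly_nonzero_on_disc a that by blast
    assume w: "norm w = 1"
    hence "w \<noteq> 0" by auto
    have "norm (poly a z) \<le> norm (poly a (inverse w))"
      using w by (intro z(2)) (simp add: norm_inverse)
    also have "\<dots> = norm (poly (reflect_poly a) w)"
      using \<open>w \<noteq> 0\<close> w by (simp add: poly_reflect_poly_nz norm_mult norm_power)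
    finally have "norm (poly a z) \<le> norm (poly (reflect_poly a) w)" .
    from le_imp_inverse_le[OF this pos]
    show "norm (poly 0 w / poly [:0, 1:] w + poly 1 w / poly (reflect_poly a) w)
                    \<le> inverse (norm (poly a z))"
      by (simp add: norm_divide inverse_eq_divide)
  qed auto
  thus ?thesis using z pos lead by (intro exI[of _ z]) (simp add: field_simps)
qed

section \<open>Minima of the modulus on compact sets\<close>

lemma min_modulus_le: "z \<in> S \<Longrightarrow> min_modulus S p \<le> norm (poly p z)"
  unfolding min_modulus_def by (rule cINF_lower) (auto intro!: bdd_belowI2[of _ 0])

lemma min_modulus_pos:
  assumes "compact S" "S \<noteq> {}" "\<And>z. z \<in> S \<Longrightarrow> poly p z \<noteq> 0"
  shows "min_modulus S p > 0"
proof -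
  have "continuous_on S (\<lambda>z. norm (poly p z))"
    by (intro continuous_intros)
  from continuous_attains_inf[OF assms(1,2) this]
  obtain z where z: "z \<in> S" "\<forall>w\<in>S. norm (poly p z) \<le> norm (poly p w)"
    by blast
  have "0 < norm (poly p z)" using assms(3) z by simp
  also have "\<dots> \<le> min_modulus S p"
    unfolding min_modulus_def using z assms(2) by (intro cINF_greatest) auto
  finally show ?thesis .
qed

lemma compact_closed_annulus: "compact (closed_annulus r R)"
proof -
  have "closed_annulus r R = cball 0 R - ball 0 r"
    by (auto simp: closed_annulus_def)
  thus ?thesis by (simp add: compact_diff)
qed

theorem theorem5p4:
  fixes p p1 p2 pt pt1 pt2 :: "complex poly"
    and r R m1 mK \<rho> \<delta> \<delta>0 q :: real
    and \<nu> \<kappa> n0 n :: nat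
  assumes radii: "0 < r" "r < 1" "1 < R"
    and p: "lead_coeff p = 1" "degree p = \<nu>" "\<nu> > 1" "poly p 0 \<noteq> 0"
    and no_zeros: "\<forall>z\<in>closed_annulus r R. poly p z \<noteq> 0"
    and \<kappa>: "\<kappa> = zeros_in_unit_disc p" "0 < \<kappa>" "\<kappa> < \<nu>"
    and n0: "n0 = max \<kappa> (\<nu> - \<kappa>)"
    and p_fact: "p = p1 * p2"
    and p1: "lead_coeff p1 = 1" "degree p1 = \<kappa>" "\<forall>z. poly p1 z = 0 \<longrightarrow> norm z < r"
    and p2: "lead_coeff p2 = 1" "degree p2 = \<nu> - \<kappa>" "\<forall>z. poly p2 z = 0 \<longrightarrow> norm z > R"
    and m1: "m1 = min_modulus (sphere 0 1) p"
    and mK: "mK = min_modulus (closed_annulus r R) p"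
    and \<rho>: "\<rho> = max r (1 / R)"
    and \<delta>: "\<delta> = exp (2 * catalan_const / pi)"
    and \<delta>0: "coeff_norm p1 * coeff_norm p2 \<le> \<delta>0 * coeff_norm p"
      "1 \<le> \<delta>0" "\<delta>0 \<le> \<delta> ^ \<nu> * sqrt ((real \<kappa> + 1) * (real \<nu> - real \<kappa> + 1))"
    and q: "0 < q" "q < 1"
    and n: "n \<ge> n0 + 1"
    and pt: "pt \<noteq> p" "degree pt = \<nu>"
    and close: "coeff_norm (p - pt) \<le>
      min (q * m1) (q * (1 - q) * m1\<^sup>2 / ((2 * real n + 1) * \<delta>0 * coeff_norm p))"
    and pt_fact: "pt = pt1 * pt2"
    and pt1: "lead_coeff pt1 = 1" "degree pt1 = \<kappa>" "\<forall>z. poly pt1 z = 0 \<longrightarrow> norm z < 1"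
    and pt2: "\<forall>z. poly pt2 z = 0 \<longrightarrow> norm z > 1"
  shows "coeff_norm (p1 - pt1) <
      (2 * real n + 1) * \<delta>0 * coeff_norm p / ((1 - q)\<^sup>2 * m1\<^sup>2)
        * (\<delta>0 * coeff_norm p / mK * ((1 + \<rho>) / (1 - \<rho>)) + 1) * coeff_norm (p - pt) \<and>
    coeff_norm (p2 - pt2) <
      (2 * real n + 1) * \<delta>0\<^sup>2 * (coeff_norm p)\<^sup>2 / ((1 - q)\<^sup>2 * m1\<^sup>2)
        * coeff_norm (p - pt)"
proof -

  \<comment> \<open>Degrees and splittings of the perturbation\<close>
  define u v \<epsilon> P \<mu> where "u = p1 - pt1" and "v = p2 - pt2" and "\<epsilon> = coeff_norm (p - pt)"
    and "P = coeff_norm p" and "\<mu> = \<nu> - \<kappa>"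
  have nz: "p \<noteq> 0" "p1 \<noteq> 0" "p2 \<noteq> 0" "pt \<noteq> 0" "pt1 \<noteq> 0" "pt2 \<noteq> 0"
    using p p1 p2 pt pt1 pt_fact by auto
  have deg_pt2: "degree pt2 = \<mu>"
    using pt(2) pt1(2) nz by (simp add: pt_fact degree_mult_eq \<mu>_def)
  \<comment> \<open>The leading terms of the two monic factors cancel; \<open>\<kappa> > 0\<close>
    keeps the inequality strict even for \<open>u = 0\<close>, whose degree is 0.\<close>
  have deg_u: "degree u < \<kappa>"
  proof -
    have "coeff u \<kappa> = 0" using p1 pt1 by (simp add: u_def)
    moreover have "degree u \<le> \<kappa>"
      unfolding u_def using p1(2) pt1(2) by (intro degree_diff_le) auto
    ultimately show ?thesis using \<kappa>(2)
      by (metis degree_0 leading_coeff_0_iff order_le_less)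
  qed
  have deg_v: "degree v \<le> \<mu>"
    unfolding v_def using p2(2) deg_pt2 by (intro degree_diff_le) (auto simp: \<mu>_def)
  have split: "p - pt = u * p2 + pt1 * v" "p - pt = u * pt2 + p1 * v"
    by (simp_all add: u_def v_def p_fact pt_fact algebra_simps)

  have inner: "poly p1 z \<noteq> 0" "poly pt1 z \<noteq> 0" if "1 \<le> norm z" for z
    using p1(3) pt1(3) radii that by fastforce+
  have outer: "poly p2 z \<noteq> 0" "poly pt2 z \<noteq> 0" if "norm z \<le> 1" for z
    using p2(3) pt2 radii that by fastforce+

  have m1_pos: "m1 > 0"
    unfolding m1 p_fact using inner outer by (intro min_modulus_pos) auto
  have "1 \<in> closed_annulus r R" using radii by (simp add: closed_annulus_def)
  hence mK_pos: "mK > 0"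
    unfolding mK using no_zeros by (intro min_modulus_pos compact_closed_annulus) auto
  have P_ge: "m1 \<le> P"
    using order.trans[OF min_modulus_le[of 1 "sphere 0 1" p] norm_poly_le_coeff_norm[of 1 p]]
    by (simp add: m1 P_def)
  have P_pos: "P > 0" using m1_pos P_ge by linarith
  \<comment> \<open>Positivity makes \<open>c\<close> below positive, on which the strict
    inequalities of the conclusion rest.\<close>
  have \<epsilon>_pos: "\<epsilon> > 0"
  proof -
    have "0 < norm (lead_coeff (p - pt))"
      using pt(1) by (metis eq_iff_diff_eq_0 leading_coeff_0_iff zero_less_norm_iff)
    also have "\<dots> \<le> \<epsilon>"
      unfolding \<epsilon>_def coeff_norm_def by (rule member_le_sum) auto
    finally show ?thesis .
  qed
  have \<delta>0_pos: "\<delta>0 > 0" using \<delta>0(2) by simp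
  have norms: "coeff_norm p1 * coeff_norm p2 \<le> \<delta>0 * P" using \<delta>0(1) by (simp add: P_def)
  have norms_ge: "coeff_norm p1 \<ge> 1"
    unfolding coeff_norm_def using p1(1)
      member_le_sum[of "degree p1" "{..degree p1}" "\<lambda>i. norm (coeff p1 i)"] by simp
  have nonneg: "coeff_norm f \<ge> 0" for f by (simp add: coeff_norm_def sum_nonneg)
  have p2_le: "coeff_norm p2 \<le> \<delta>0 * P"
    using norms mult_right_mono[OF norms_ge nonneg[of p2]] by simp
  \<comment> \<open>At a point of the unit circle where \<open>p1\<close> has modulus at most 1,
    \<open>p\<close> is no larger than \<open>p2\<close>. Together with \<open>norms\<close> this
    will bound \<open>coeff_norm p1\<close> by \<open>\<delta>0 * P / mK\<close>.\<close>
  have mK_le: "mK \<le> coeff_norm p2"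
  proof -
    obtain z where z: "norm z = 1" "norm (poly p1 z) \<le> 1"
      using monic_exists_norm_le_1[of p1] inner p1(1) by blast
    have "z \<in> closed_annulus r R" using z radii by (simp add: closed_annulus_def)
    hence "mK \<le> norm (poly p1 z) * norm (poly p2 z)"
      using min_modulus_le[of z "closed_annulus r R" p] by (simp add: mK p_fact norm_mult)
    also have "\<dots> \<le> 1 * coeff_norm p2"
      using z by (intro mult_mono norm_poly_le_coeff_norm) auto
    finally show ?thesis by simp
  qed

  \<comment> \<open>Lower bounds on the unit circle\<close>
  have p_ge: "norm (poly p z) \<ge> m1" if "norm z = 1" for z
    using min_modulus_le[of z "sphere 0 1" p] that by (simp add: m1)
  have d_le: "norm (poly (p - pt) z) \<le> \<epsilon>" if "norm z = 1" for z
    unfolding \<epsilon>_def by (rule norm_poly_le_coeff_norm[OF that])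
  have pt_ge: "norm (poly pt z) \<ge> (1 - q) * m1" if "norm z = 1" for z
  proof -
    have "\<epsilon> \<le> q * m1" using close by (simp add: \<epsilon>_def)
    thus ?thesis using p_ge[OF that] d_le[OF that] norm_triangle_ineq2[of "poly p z" "poly pt z"]
      by (simp add: algebra_simps)
  qed
  define D where "D = (1 - q) * m1\<^sup>2"
  have D_pos: "D > 0" using q m1_pos by (simp add: D_def)
  \<comment> \<open>\<open>a'\<close> and \<open>b'\<close> are the cofactors completing
    \<open>a * b\<close> to \<open>p * pt\<close>. As \<open>D\<close> bounds \<open>p * pt\<close>
    from below on the circle, the reciprocal of \<open>a * b\<close> is at most the product of their
    norms over \<open>D\<close>.\<close>
  have quot_le: "norm (poly (p - pt) z / (poly a z * poly b z)) \<le> \<epsilon> * (coeff_norm a' * coeff_norm b') / D"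
    if "norm z = 1" "a * a' * (b * b') = p * pt" "poly a z \<noteq> 0" "poly b z \<noteq> 0" for a a' b b' z
  proof -
    have eq: "poly a z * poly b z * (poly a' z * poly b' z) = poly p z * poly pt z"
      using arg_cong[OF that(2), of "\<lambda>f. poly f z"] by (simp add: mult_ac)
    have "D \<le> norm (poly p z) * norm (poly pt z)"
      using mult_mono[OF p_ge[OF that(1)] pt_ge[OF that(1)]] m1_pos q
      by (simp add: D_def power2_eq_square mult_ac)
    also have "\<dots> = norm (poly a z * poly b z) * (norm (poly a' z) * norm (poly b' z))"
      using eq by (metis norm_mult)
    also have "\<dots> \<le> norm (poly a z * poly b z) * (coeff_norm a' * coeff_norm b')"
      by (intro mult_left_mono mult_mono norm_poly_le_coeff_norm that nonneg) auto
    finally have "D \<le> norm (poly a z * poly b z) * (coeff_norm a' * coeff_norm b')" .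
    hence "norm (poly (p - pt) z) * D
        \<le> \<epsilon> * (norm (poly a z * poly b z) * (coeff_norm a' * coeff_norm b'))"
      using D_pos \<epsilon>_pos by (intro mult_mono d_le that) auto
    thus ?thesis using that(3,4) D_pos by (simp add: norm_divide norm_mult field_simps)
  qed

  \<comment> \<open>Absorption of the perturbed factor\<close>
  define N where "N = 2 * real n + 1"
  have N: "real \<mu> + 1 < N" "real \<kappa> < N" using n by (auto simp: N_def n0 \<mu>_def)
  define c where "c = \<delta>0 * P * \<epsilon> / D"
  have c_pos: "c > 0" using \<delta>0_pos P_pos \<epsilon>_pos D_pos by (simp add: c_def)
  \<comment> \<open>This is the second bound in the minimum assumed in \<open>close\<close>,
    rearranged.\<close>
  have c_le: "N * c \<le> q"
  proof -
    have "\<epsilon> \<le> q * D / (N * \<delta>0 * P)"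
      using close by (simp add: \<epsilon>_def P_def D_def N_def mult_ac)
    thus ?thesis using D_pos \<delta>0_pos P_pos N by (simp add: c_def field_simps)
  qed
  \<comment> \<open>\<open>x\<close> is the error in a factor, \<open>y\<close> and
    \<open>y'\<close> the norms of the exact and perturbed factor. Since
    \<open>k * c \<le> q < 1\<close>, the error on the right is absorbed on the left at the cost of
    \<open>1 / (1 - q)\<close>.\<close>
  have bootstrap: "x \<le> k * c * y / (1 - q)"
    if "x \<le> k * c * y'" "y' \<le> y + x" "0 \<le> k" "k < N" "0 \<le> x" for x y y' k
  proof -
    have "k * c \<le> q" using mult_right_mono[of k N c] that c_pos c_le by linarith
    moreover have "x \<le> k * c * y + k * c * x"
      using order.trans[OF that(1) mult_left_mono[OF that(2), of "k * c"]] that c_pos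
      by (simp add: algebra_simps)
    ultimately have "x \<le> k * c * y + q * x" using mult_right_mono[of "k * c" q x] that(5) by linarith
    thus ?thesis using q by (simp add: field_simps)
  qed

  \<comment> \<open>The outer factor\<close>
  have "coeff_norm v \<le> (real \<mu> + 1) * (coeff_norm p2 * (\<epsilon> * (coeff_norm p1 * coeff_norm pt2) / D))"
  proof (rule coeff_norm_outer_le[of pt1 p2 u])
    fix z :: complex assume z: "norm z = 1"
    hence nz: "poly pt1 z \<noteq> 0" "poly p2 z \<noteq> 0" using inner outer by auto
    have "poly u z / poly pt1 z + poly v z / poly p2 z = poly (p - pt) z / (poly p2 z * poly pt1 z)"
      unfolding split(1) using nz by (simp add: field_simps)
    thus "norm (poly u z / poly pt1 z + poly v z / poly p2 z)
            \<le> \<epsilon> * (coeff_norm p1 * coeff_norm pt2) / D"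
      using quot_le[OF z, of p2 p1 pt1 pt2] nz by (simp add: p_fact pt_fact mult_ac)
  qed (use inner outer deg_u deg_v pt1 in auto)
  also have "\<dots> = (real \<mu> + 1) * \<epsilon> / D * coeff_norm pt2 * (coeff_norm p1 * coeff_norm p2)"
    by (simp add: mult_ac)
  \<comment> \<open>The norm of \<open>p2\<close> from the coefficient estimate meets the norm of
    the cofactor \<open>p1\<close>, so \<delta>0 controls their product and only \<open>pt2\<close>
    remains.\<close>
  also have "\<dots> \<le> (real \<mu> + 1) * \<epsilon> / D * coeff_norm pt2 * (\<delta>0 * P)"
    using D_pos \<epsilon>_pos by (intro mult_left_mono norms) (auto intro!: divide_nonneg_pos mult_nonneg_nonneg nonneg)
  finally have "coeff_norm v \<le> (real \<mu> + 1) * c * coeff_norm pt2"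
    by (simp add: c_def mult_ac)
  from bootstrap[OF this coeff_norm_triangle[of pt2 p2, folded v_def] _ N(1) nonneg]
  have "coeff_norm v \<le> (real \<mu> + 1) * c * coeff_norm p2 / (1 - q)" by simp
  also have "\<dots> \<le> (real \<mu> + 1) * c * (\<delta>0 * P) / (1 - q)"
    using q c_pos by (intro divide_right_mono mult_left_mono p2_le) auto
  also have "\<dots> < N * c * (\<delta>0 * P) / (1 - q)"
    using q c_pos \<delta>0_pos P_pos N by (intro divide_strict_right_mono mult_strict_right_mono) auto
  \<comment> \<open>One factor \<open>1 - q\<close> comes from \<open>D\<close>, the other from the
    absorption.\<close>
  also have "\<dots> = N * \<delta>0\<^sup>2 * P\<^sup>2 / ((1 - q)\<^sup>2 * m1\<^sup>2) * \<epsilon>"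
    by (simp add: c_def D_def power2_eq_square mult_ac)
  finally have v_less: "coeff_norm v < N * \<delta>0\<^sup>2 * P\<^sup>2 / ((1 - q)\<^sup>2 * m1\<^sup>2) * \<epsilon>" .

  \<comment> \<open>The inner factor\<close>
  have "coeff_norm u \<le> real (degree p1) * (coeff_norm p1 * (\<epsilon> * (coeff_norm p2 * coeff_norm pt1) / D))"
  proof (rule coeff_norm_inner_le[of p1 pt2 u v])
    fix z :: complex assume z: "norm z = 1"
    hence nz: "poly p1 z \<noteq> 0" "poly pt2 z \<noteq> 0" using inner outer by auto
    have "poly u z / poly p1 z + poly v z / poly pt2 z = poly (p - pt) z / (poly p1 z * poly pt2 z)"
      unfolding split(2) using nz by (simp add: field_simps)
    thus "norm (poly u z / poly p1 z + poly v z / poly pt2 z)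
            \<le> \<epsilon> * (coeff_norm p2 * coeff_norm pt1) / D"
      using quot_le[OF z, of p1 p2 pt2 pt1] nz by (simp add: p_fact pt_fact mult_ac)
  qed (use inner outer deg_u deg_v p1 deg_pt2 in auto)
  also have "\<dots> = real \<kappa> * \<epsilon> / D * coeff_norm pt1 * (coeff_norm p1 * coeff_norm p2)"
    by (simp add: mult_ac p1)
  also have "\<dots> \<le> real \<kappa> * \<epsilon> / D * coeff_norm pt1 * (\<delta>0 * P)"
    using D_pos \<epsilon>_pos by (intro mult_left_mono norms) (auto intro!: divide_nonneg_pos mult_nonneg_nonneg nonneg)
  finally have "coeff_norm u \<le> real \<kappa> * c * coeff_norm pt1"
    by (simp add: c_def mult_ac)
  from bootstrap[OF this coeff_norm_triangle[of pt1 p1, folded u_def] _ N(2) nonneg]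
  have "coeff_norm u \<le> real \<kappa> * c * coeff_norm p1 / (1 - q)" by simp
  \<comment> \<open>The bracket dominates \<open>coeff_norm p1\<close>: its first factor does by
    \<open>mK_le\<close> and \<open>norms\<close>, and \<open>(1 + \<rho>) / (1 - \<rho>)\<close> is
    at least 1.\<close>
  also have "\<dots> < N * c * (\<delta>0 * P / mK * ((1 + \<rho>) / (1 - \<rho>)) + 1) / (1 - q)"
  proof -
    have "coeff_norm p1 * mK \<le> \<delta>0 * P"
      using order.trans[OF mult_left_mono[OF mK_le nonneg] norms] .
    hence "coeff_norm p1 \<le> \<delta>0 * P / mK * 1" using mK_pos by (simp add: field_simps)
    also have "\<dots> \<le> \<delta>0 * P / mK * ((1 + \<rho>) / (1 - \<rho>))"
    proof (rule mult_left_mono)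
      have "0 < \<rho>" "\<rho> < 1" using radii by (auto simp: \<rho>)
      thus "1 \<le> (1 + \<rho>) / (1 - \<rho>)" by simp
    qed (use mK_pos \<delta>0_pos P_pos in auto)
    finally have "coeff_norm p1 \<le> \<delta>0 * P / mK * ((1 + \<rho>) / (1 - \<rho>)) + 1" by simp
    thus ?thesis using q c_pos N norms_ge
      by (intro divide_strict_right_mono mult_less_le_imp_less mult_strict_right_mono) auto
  qed
  also have "\<dots> = N * \<delta>0 * P / ((1 - q)\<^sup>2 * m1\<^sup>2) * (\<delta>0 * P / mK * ((1 + \<rho>) / (1 - \<rho>)) + 1) * \<epsilon>"
    by (simp add: c_def D_def power2_eq_square mult_ac)
  finally show ?thesis
    using v_less by (simp add: u_def v_def \<epsilon>_def P_def N_def)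
qed

end
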